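(* Let $\lambda_2=2\arcsin\sqrt{\frac12+\frac1{\sqrt{12}}}\approx 2.19$. Fix $\lambda_2<\alpha\le\pi$, and let $\epsilon=\epsilon(n)$ satisfy $\epsilon\ge C_2\left(\frac{\log n}{n}\right)^{1/2}$ and $\epsilon\to0$ as $n\to\infty$. Then, asymptotically almost surely, $$\chi\big(\mathbb{S}^2_\alpha(n,\epsilon)\big)=4.$$
   Context: $\mathbb{S}^2$ is the unit sphere in $\mathbb{R}^{3}$ with geodesic distance $\mathbf{d}$ and uniform probability measure. The number $\lambda_2$ is the geodesic diameter of the radial projection to $\mathbb{S}^2$ of a face of an inscribed regular tetrahedron. For $\alpha,\epsilon\ge 0$ and $X\subset\mathbb{S}^2$, $\mathbb{S}^2_\alpha(X,\epsilon)$ is the graph with vertex set $X$ and $x\sim y$ iff $x\ne y$ and $\alpha-\epsilon\le \mathbf{d}(x,y)\le\alpha+\epsilon$. The random $\epsilon$-distance graph $\mathbb{S}^2_\alpha(n,\epsilon)$ is $\mathbb{S}^2_\alpha(X,\epsilon)$ with $X=\{X_1,\dots,X_n\}$, where the $X_i$ are i.i.d. uniform on $\mathbb{S}^2$. An event (depending on $n$) holds asymptotically almost surely (a.a.s.) if its probability tends to $1$ as $n\to\infty$. $\chi$ is the chromatic number. A set $X\subset\mathbb{S}^2$ is a $\delta$-net if every point of $\mathbb{S}^2$ is at geodesic distance at most $\delta$ from some point of $X$. $C_2$ denotes a fixed constant with the property that whenever $\epsilon(n)\ge C_2(\log n/n)^{1/2}$ and $\epsilon(n)\to0$, a.a.s.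 $n$ i.i.d. uniform points of $\mathbb{S}^2$ form an $(\epsilon/4)$-net of $\mathbb{S}^2$ (such a constant exists). *)

theory Defs
  imports "HOL-Probability.Probability"
begin

type_synonym 'a ugraph = "'a set \<times> ('a \<times> 'a) set"

definition colourable :: "'a ugraph \<Rightarrow> nat \<Rightarrow> bool" where
  "colourable G k \<longleftrightarrow>
     (\<exists>c. c \<in> fst G \<rightarrow> {..<k} \<and> (\<forall>(x, y) \<in> snd G. c x \<noteq> c y))"

text \<open>Meaningful for loop-free graphs on a finite vertex set, for which a proper colouring with
  finitely many colours exists.\<close>

definition chromatic_number :: "'a ugraph \<Rightarrow> nat" where
  "chromatic_number G = (LEAST k. colourable G k)"

abbreviation S2 :: "(real^3) set" where
  "S2 \<equiv> sphere 0 1"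

text \<open>Arc length of the shorter great-circle arc between two unit vectors.\<close>

definition geodesic_dist :: "real^3 \<Rightarrow> real^3 \<Rightarrow> real" where
  "geodesic_dist x y = arccos (x \<bullet> y)"

text \<open>The edge set is a symmetric irreflexive relation encoding an undirected graph.\<close>

definition distance_graph :: "real \<Rightarrow> real \<Rightarrow> (real^3) set \<Rightarrow> (real^3) ugraph" where
  "distance_graph \<alpha> \<epsilon> X =
     (X, {(x, y). x \<in> X \<and> y \<in> X \<and> x \<noteq> y \<and>
            \<alpha> - \<epsilon> \<le> geodesic_dist x y \<and> geodesic_dist x y \<le> \<alpha> + \<epsilon>})"

definition geodesic_net :: "real \<Rightarrow> (real^3) set \<Rightarrow> bool" where
  "geodesic_net \<delta> X \<longleftrightarrow> (\<forall>y\<in>S2. \<exists>x\<in>X. geodesic_dist y x \<le> \<delta>)"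

text \<open>Normalised surface measure, obtained as the image of the uniform distribution on the unit
  ball under the radial projection \<^term>\<open>sgn :: real^3 \<Rightarrow> real^3\<close>. The null event
  \<^term>\<open>sgn x = 0\<close> is discarded by the restriction, so that the sample space is exactly the sphere.
  The lemmas below show that this is a rotation-invariant probability measure on its Borel sets.\<close>

definition sphere_uniform :: "(real^3) measure" where
  "sphere_uniform =
     restrict_space (distr (uniform_measure lborel (ball 0 1)) borel sgn) S2"

lemma space_sphere_uniform: "space sphere_uniform = S2"
  by (simp add: sphere_uniform_def space_restrict_space)

lemma sets_sphere_uniform: "sets sphere_uniform = sets (restrict_space borel S2)"
  unfolding sphere_uniform_def by (rule sets_restrict_space_cong) simp

lemma emeasure_sphere_uniform:
  assumes "A \<in> sets borel" "A \<subseteq> S2"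
  shows "emeasure sphere_uniform A =
    emeasure lborel {x \<in> ball 0 1. sgn x \<in> A} / emeasure lborel (ball (0::real^3) 1)"
proof -
  have m: "(sgn :: real^3 \<Rightarrow> real^3) -` A \<in> sets borel"
    using measurable_sets[OF borel_measurable_sgn assms(1)] by simp
  have "emeasure sphere_uniform A
      = emeasure (distr (uniform_measure lborel (ball 0 1)) borel sgn) A"
    unfolding sphere_uniform_def using assms
    by (intro emeasure_restrict_space) auto
  also have "\<dots> = emeasure (uniform_measure lborel (ball 0 1)) (sgn -` A)"
    by (subst emeasure_distr) (use assms borel_measurable_sgn in auto)
  also have "\<dots> = emeasure lborel (ball 0 1 \<inter> sgn -` A) / emeasure lborel (ball (0::real^3) 1)"
    using m by (intro emeasure_uniform_measure) auto
  also have "ball 0 1 \<inter> sgn -` A = {x \<in> ball 0 1. sgn x \<in> A}" by auto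
  finally show ?thesis .
qed

lemma emeasure_unit_ball3:
  "emeasure lborel (ball (0::real^3) 1) \<noteq> 0" "emeasure lborel (ball (0::real^3) 1) \<noteq> \<infinity>"
proof -
  show "emeasure lborel (ball (0::real^3) 1) \<noteq> \<infinity>"
    using emeasure_lborel_ball_finite[of "0::real^3" 1] by simp
  show "emeasure lborel (ball (0::real^3) 1) \<noteq> 0"
    using open_not_negligible[of "ball (0::real^3) 1"]
    by (auto simp: negligible_iff_null_sets null_sets_def)
qed

lemma prob_space_sphere_uniform: "prob_space sphere_uniform"
proof
  have "emeasure lborel {x \<in> ball 0 1. sgn x \<in> S2} = emeasure lborel (ball 0 1 - {0::real^3})"
    by (rule arg_cong[where f = "emeasure lborel"]) (auto simp: norm_sgn)
  also have "\<dots> = emeasure lborel (ball (0::real^3) 1)"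
    by (intro emeasure_Diff_null_set) auto
  finally show "emeasure sphere_uniform (space sphere_uniform) = 1"
    using emeasure_unit_ball3
    by (simp add: space_sphere_uniform emeasure_sphere_uniform ennreal_divide_self top.not_eq_extremum)
qed

lemma sphere_uniform_rotation_invariant:
  assumes f: "orthogonal_transformation f"
  shows "distr sphere_uniform sphere_uniform f = sphere_uniform"
proof (rule measure_eqI)
  fix A assume "A \<in> sets (distr sphere_uniform sphere_uniform f)"
  then have A: "A \<in> sets sphere_uniform" by simp
  then have AB: "A \<in> sets borel" "A \<subseteq> S2"
    by (auto simp: sets_sphere_uniform sets_restrict_space)
  have nf: "norm (f x) = norm x" for x
    using f by (simp add: orthogonal_transformation)
  have lin: "linear f" using f by (rule orthogonal_transformation_linear)
  have contf: "continuous_on UNIV f"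
    using lin by (simp add: linear_continuous_on linear_conv_bounded_linear)
  have fm: "f \<in> borel_measurable borel"
    using contf by (rule borel_measurable_continuous_onI)
  have fS: "f \<in> measurable sphere_uniform sphere_uniform"
    using fm nf unfolding measurable_cong_sets[OF sets_sphere_uniform sets_sphere_uniform]
    by (intro measurable_restrict_space3) auto
  have pre: "f -` A \<in> sets borel"
    using measurable_sets[OF fm AB(1)] by simp
  have sg: "sgn (f x) = f (sgn x)" for x
    using lin by (simp add: sgn_div_norm nf linear_scale)
  let ?U = "{x \<in> ball 0 1. sgn x \<in> A}" and ?V = "{x \<in> ball 0 1. sgn x \<in> f -` A}"
  have meas: "{x \<in> ball 0 1. sgn x \<in> B} \<in> sets borel" if "B \<in> sets borel" for B :: "(real^3) set"
  proof -
    have "{x \<in> ball 0 1. sgn x \<in> B} = ball 0 1 \<inter> sgn -` B" by auto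
    then show ?thesis using measurable_sets[OF borel_measurable_sgn that] by simp
  qed
  have surjf: "surj f" using f by (rule orthogonal_transformation_surj)
  have UV: "?U = f ` ?V"
  proof safe
    fix x assume "x \<in> ball (0::real^3) 1" "sgn x \<in> A"
    moreover obtain y where "x = f y" using surjf by (metis surjD)
    ultimately show "x \<in> f ` ?V" using nf sg by auto
  qed (use nf sg in auto)
  have bV: "?V \<in> lmeasurable"
    by (rule bounded_set_imp_lmeasurable) (use meas[OF pre] in \<open>auto intro: bounded_subset[of "ball 0 1"]\<close>)
  have bU: "?U \<in> lmeasurable"
    by (rule bounded_set_imp_lmeasurable) (use meas[OF AB(1)] in \<open>auto intro: bounded_subset[of "ball 0 1"]\<close>)
  have "measure lebesgue ?U = measure lebesgue ?V"
    unfolding UV by (rule measure_orthogonal_image[OF f bV])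
  then have "emeasure lebesgue ?U = emeasure lebesgue ?V"
    using bU bV by (simp add: emeasure_eq_measure2)
  then have eq: "emeasure lborel ?U = emeasure lborel ?V"
    using meas[OF pre] meas[OF AB(1)] by simp
  have "emeasure (distr sphere_uniform sphere_uniform f) A = emeasure sphere_uniform (f -` A \<inter> S2)"
    using fS A by (simp add: emeasure_distr space_sphere_uniform)
  also have "f -` A \<inter> S2 = f -` A" using AB(2) nf by auto
  also have "emeasure sphere_uniform (f -` A) = emeasure sphere_uniform A"
    using AB pre nf eq by (subst (1 2) emeasure_sphere_uniform) auto
  finally show "emeasure (distr sphere_uniform sphere_uniform f) A = emeasure sphere_uniform A" .
qed simp

text \<open>The joint law of \<open>X\<^sub>1, \<dots>, X\<^sub>n\<close>; the random point \<open>X\<^sub>i\<close> is the coordinate \<open>\<omega> i\<close>.\<close>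

definition iid_points :: "nat \<Rightarrow> (nat \<Rightarrow> real^3) measure" where
  "iid_points n = PiM {1..n} (\<lambda>_. sphere_uniform)"

definition aas :: "(nat \<Rightarrow> 'a measure) \<Rightarrow> (nat \<Rightarrow> 'a \<Rightarrow> bool) \<Rightarrow> bool" where
  "aas M P \<longleftrightarrow> (\<lambda>n. \<P>(\<omega> in M n. P n \<omega>)) \<longlonglongrightarrow> 1"

text \<open>The defining property of the constant in the lower bound on \<open>\<epsilon>\<close>. It forces \<open>C > 0\<close>,
  since a finite set is never a net of radius \<open>0\<close>.\<close>

definition net_constant :: "real \<Rightarrow> bool" where
  "net_constant C \<longleftrightarrow>
     (\<forall>\<epsilon>. (\<forall>n\<ge>1. \<epsilon> n \<ge> C * sqrt (ln (real n) / real n)) \<longrightarrow> \<epsilon> \<longlonglongrightarrow> 0 \<longrightarrow>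
        aas iid_points (\<lambda>n \<omega>. geodesic_net (\<epsilon> n / 4) (\<omega> ` {1..n})))"

text \<open>The geodesic diameter of the radially projected face of an inscribed regular tetrahedron, attained
  between a vertex and the midpoint of the opposite side; its cosine is \<open>-1 / sqrt 3\<close>.\<close>

definition lambda2 :: real where
  "lambda2 = 2 * arcsin (sqrt (1 / 2 + 1 / sqrt 12))"

end

theory Submission
  imports Defs
begin

text \<open>The four radially projected faces of an inscribed regular tetrahedron have diameter
  \<open>\<lambda>\<^sub>2 < \<alpha> - \<epsilon>\<close>, so they give a proper 4-colouring. Conversely, for a 3-colouring let three weight
  functions on the sphere measure how near a point is to each colour class of the net. At two
  points at distance \<open>\<alpha>\<close> the weights have disjoint nonempty supports, so the weights modulo
  \<open>(1, 1, 1)\<close> form a continuous map into the plane that separates all such pairs. This is impossible: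
  every continuous map from the sphere to the plane takes equal values at some two points at any
  prescribed distance. The net property alone excludes three colours, and the event of being
  4-chromatic is measurable because it only involves the colourings of the indices.\<close>

section \<open>Equal values at a prescribed distance\<close>

text \<open>A zero-free \<open>f\<close> has a continuous logarithm \<open>g\<close> on
  \<open>S\<close>. Oddness makes every value of \<open>g (T x) - g x\<close> an odd multiple of
  \<i> \<pi>, so by connectedness this difference is a constant \<open>k\<close>. Summed along a
  periodic orbit it gives \<open>n * k = 0\<close>, whereas \<open>exp k = -1\<close>.\<close>

lemma antisymmetric_map_has_zero:
  fixes f :: "'a::real_normed_vector \<Rightarrow> complex"
  assumes S: "simply_connected S" "locally path_connected S"
    and f: "continuous_on S f" and T: "continuous_on S T" "T \<in> S \<rightarrow> S"
    and odd: "\<And>x. x \<in> S \<Longrightarrow> f (T x) = - f x"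
    and per: "p \<in> S" "(T ^^ n) p = p" "n > 0"
  shows "\<exists>x\<in>S. f x = 0"
proof (rule ccontr)
  assume "\<not> ?thesis"
  then obtain g where g: "continuous_on S g" "\<And>x. x \<in> S \<Longrightarrow> f x = exp (g x)"
    using continuous_logarithm_on_simply_connected[OF f S] by metis
  define h where "h x = g (T x) - g x" for x
  have eh: "exp (h x) = -1" if "x \<in> S" for x
  proof -
    have "T x \<in> S"
      using T(2) that by blast
    then have "exp (g (T x)) = - exp (g x)"
      using odd[OF that] g(2)[of "T x"] g(2)[OF that] by simp
    then show ?thesis
      by (simp add: h_def exp_diff)
  qed
  have "h constant_on S"
  proof (rule continuous_discrete_range_constant)
    show "connected S"
      using S(1) by (rule simply_connected_imp_connected)
    have "continuous_on S (\<lambda>x. g (T x))"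
      using continuous_on_compose2[OF g(1) T(1)] T(2) by auto
    then show "continuous_on S h"
      unfolding h_def using g(1) by (intro continuous_intros)
    fix x assume x: "x \<in> S"
    have "2 * pi \<le> norm (h y - h x)" if "y \<in> S" "h y \<noteq> h x" for y
    proof -
      have "exp (h y - h x) = 1"
        using eh x that by (simp add: exp_diff)
      then obtain k :: int where k: "Re (h y - h x) = 0" "Im (h y - h x) = of_int (2 * k) * pi"
        unfolding exp_eq_1 by auto
      with that have "k \<noteq> 0"
        by (auto simp: complex_eq_iff)
      then have "1 \<le> \<bar>real_of_int k\<bar>"
        by linarith
      then have "2 * pi \<le> \<bar>Im (h y - h x)\<bar>"
        unfolding k by (simp add: abs_mult)
      also have "\<dots> \<le> norm (h y - h x)"
        by (rule abs_Im_le_cmod)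
      finally show ?thesis .
    qed
    then show "\<exists>e>0. \<forall>y. y \<in> S \<and> h y \<noteq> h x \<longrightarrow> e \<le> norm (h y - h x)"
      by (intro exI[of _ "2 * pi"]) auto
  qed
  then obtain k where k: "\<And>x. x \<in> S \<Longrightarrow> h x = k"
    unfolding constant_on_def by blast
  have "(T ^^ m) p \<in> S \<and> g ((T ^^ m) p) = g p + of_nat m * k" for m
  proof (induction m)
    case (Suc m)
    then show ?case
      using k[of "(T ^^ m) p"] T(2) by (auto simp: h_def algebra_simps)
  qed (use per in auto)
  from this[of n] have "k = 0"
    using per by auto
  with eh[OF per(1)] k[OF per(1)] show False
    by simp
qed

text \<open>A unit vector \<open>(z, w)\<close> of \<open>\<complex>\<^sup>2\<close> yields the Hopf axis \<open>h\<close> and a vector \<open>m\<close> orthogonal to it.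
  Multiplication by \<open>\<i>\<close> fixes \<open>h\<close> and negates \<open>m\<close>, so that it swaps \<open>a h + b m\<close> and \<open>a h - b m\<close>,
  a pair of points at prescribed distance. The swap has order four, while the sphere of all
  \<open>(z, w)\<close> is simply connected.\<close>

theorem equal_values_at_inner_product:
  fixes f :: "real^3 \<Rightarrow> complex"
  assumes f: "continuous_on S2 f" and t: "-1 \<le> t" "t \<le> 1"
  shows "\<exists>x\<in>S2. \<exists>y\<in>S2. x \<bullet> y = t \<and> f x = f y"
proof -
  \<comment> \<open>These are the cosine and sine of half of \<open>arccos t\<close>: two unit
    vectors placed symmetrically about the axis then have inner product \<open>t\<close>.\<close>
  define a where "a = sqrt ((1 + t) / 2)"
  define b where "b = sqrt ((1 - t) / 2)"
  have ab: "a\<^sup>2 + b\<^sup>2 = 1" "a\<^sup>2 - b\<^sup>2 = t"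
    using t by (simp_all add: a_def b_def field_simps)
  define h :: "complex \<times> complex \<Rightarrow> real^3" where
    "h = (\<lambda>(z, w). vector [2 * Re (cnj z * w), 2 * Im (cnj z * w), (cmod z)\<^sup>2 - (cmod w)\<^sup>2])"
  \<comment> \<open>Real part of the isotropic vector
    \<open>(z^2 - w^2, \<i> (z^2 + w^2), -2 z w)\<close>. It is homogeneous quadratic in
    \<open>(z, w)\<close>, hence changes sign under multiplication by \<i>.\<close>
  define m :: "complex \<times> complex \<Rightarrow> real^3" where
    "m = (\<lambda>(z, w). vector [Re (z\<^sup>2 - w\<^sup>2), - Im (z\<^sup>2 + w\<^sup>2), - 2 * Re (z * w)])"
  define x where "x q = a *\<^sub>R h q + b *\<^sub>R m q" for q
  define y where "y q = a *\<^sub>R h q - b *\<^sub>R m q" for q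
  define T :: "complex \<times> complex \<Rightarrow> complex \<times> complex" where
    "T = (\<lambda>(z, w). (\<i> * z, \<i> * w))"
  let ?S = "sphere (0 :: complex \<times> complex) 1"
  have orth: "h q \<bullet> h q = 1" "m q \<bullet> m q = 1" "h q \<bullet> m q = 0" if "q \<in> ?S" for q
  proof -
    obtain r s u v where q: "q = (Complex r s, Complex u v)"
      by (metis complex.exhaust surj_pair)
    have e: "r\<^sup>2 + s\<^sup>2 + u\<^sup>2 + v\<^sup>2 = 1"
      using that by (simp add: q norm_Pair cmod_def)
    have "h q \<bullet> h q = (r\<^sup>2 + s\<^sup>2 + u\<^sup>2 + v\<^sup>2)\<^sup>2"
      by (simp add: q h_def inner_vec_def sum_3 cmod_def power2_eq_square algebra_simps)
    then show "h q \<bullet> h q = 1"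
      by (simp add: e)
    have "m q \<bullet> m q = (r\<^sup>2 + s\<^sup>2 + u\<^sup>2 + v\<^sup>2)\<^sup>2"
      by (simp add: q m_def inner_vec_def sum_3 power2_eq_square algebra_simps)
    then show "m q \<bullet> m q = 1"
      by (simp add: e)
    show "h q \<bullet> m q = 0"
      by (simp add: q h_def m_def inner_vec_def sum_3 cmod_def power2_eq_square algebra_simps)
  qed
  have xyS: "x q \<in> S2" "y q \<in> S2" "x q \<bullet> y q = t" if "q \<in> ?S" for q
    using orth[OF that] ab
    by (auto simp: x_def y_def norm_eq_1 inner_commute[of "m q" "h q"] algebra_simps power2_eq_square)
  have hT: "h (T q) = h q" and mT: "m (T q) = - m q" for q
    by (auto simp: h_def m_def T_def vec_eq_iff forall_3 norm_mult power2_eq_square split: prod.splits)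
  have TS: "T \<in> ?S \<rightarrow> ?S"
    by (auto simp: T_def norm_Pair norm_mult)
  have ch: "continuous_on A (\<lambda>q. h q $ i)" and cm: "continuous_on A (\<lambda>q. m q $ i)" for A i
  proof -
    consider "i = 1" | "i = 2" | "i = 3"
      using exhaust_3 by blast
    then show "continuous_on A (\<lambda>q. h q $ i)" "continuous_on A (\<lambda>q. m q $ i)"
      by (cases; simp add: h_def m_def case_prod_unfold; intro continuous_intros)+
  qed
  have chm: "continuous_on A h" "continuous_on A m" for A
    using continuous_on_vec_lambda[of A "\<lambda>i q. h q $ i", OF ch]
      continuous_on_vec_lambda[of A "\<lambda>i q. m q $ i", OF cm] by simp_all
  have "\<exists>q\<in>?S. f (x q) - f (y q) = 0"
  proof (rule antisymmetric_map_has_zero[where T = T and p = "(1, 0)" and n = 4])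
    show "simply_connected ?S"
      by (rule simply_connected_sphere) simp
    show "locally path_connected ?S"
      by (rule locally_path_connected_sphere)
    have "continuous_on ?S x" "continuous_on ?S y"
      unfolding x_def y_def by (intro continuous_intros chm)+
    then have "continuous_on ?S (\<lambda>q. f (x q))" "continuous_on ?S (\<lambda>q. f (y q))"
      using xyS by (auto intro!: continuous_on_compose2[OF f])
    then show "continuous_on ?S (\<lambda>q. f (x q) - f (y q))"
      by (intro continuous_intros)
    show "continuous_on ?S T"
      unfolding T_def case_prod_unfold by (intro continuous_intros)
    show "T \<in> ?S \<rightarrow> ?S"
      by (rule TS)
    show "f (x (T q)) - f (y (T q)) = - (f (x q) - f (y q))" for q
      by (simp add: x_def y_def hT mT)
    show "(1, 0) \<in> ?S"
      by (simp add: norm_Pair)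
    show "(T ^^ 4) (1, 0) = (1, 0)"
      by (simp add: T_def eval_nat_numeral)
  qed simp
  then show ?thesis
    using xyS by (metis eq_iff_diff_eq_0)
qed

section \<open>The geodesic distance\<close>

lemma abs_inner_S2: "x \<in> S2 \<Longrightarrow> y \<in> S2 \<Longrightarrow> \<bar>x \<bullet> y\<bar> \<le> 1"
  using Cauchy_Schwarz_ineq2[of x y] by simp

lemma geodesic_dist_commute: "geodesic_dist x y = geodesic_dist y x"
  by (simp add: geodesic_dist_def inner_commute)

lemma cos_geodesic_dist: "x \<in> S2 \<Longrightarrow> y \<in> S2 \<Longrightarrow> cos (geodesic_dist x y) = x \<bullet> y"
  unfolding geodesic_dist_def using abs_inner_S2 by (simp add: abs_le_iff)

lemma geodesic_dist_bounds:
  assumes "x \<in> S2" "y \<in> S2"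
  shows "0 \<le> geodesic_dist x y" "geodesic_dist x y \<le> pi"
  unfolding geodesic_dist_def using abs_inner_S2[OF assms]
  by (auto simp: abs_le_iff intro!: arccos_lbound arccos_ubound)

lemma geodesic_dist_less_iff:
  assumes "x \<in> S2" "y \<in> S2" "0 \<le> r" "r \<le> pi"
  shows "geodesic_dist x y < r \<longleftrightarrow> cos r < x \<bullet> y"
  using cos_mono_less_eq[of r "geodesic_dist x y"] assms
  by (simp add: cos_geodesic_dist geodesic_dist_bounds)

text \<open>The components of \<open>x\<close> and \<open>z\<close> orthogonal to \<open>y\<close>
  have norms equal to the sines of the two distances. Cauchy-Schwarz for these components, combined
  with the addition formula for cosine, gives the claim; if the sum exceeds \<pi>, the bound is
  trivial.\<close>

lemma geodesic_dist_triangle: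
  assumes S: "x \<in> S2" "y \<in> S2" "z \<in> S2"
  shows "geodesic_dist x z \<le> geodesic_dist x y + geodesic_dist y z"
proof (cases "geodesic_dist x y + geodesic_dist y z \<le> pi")
  case True
  let ?p = "x - (x \<bullet> y) *\<^sub>R y" and ?r = "z - (z \<bullet> y) *\<^sub>R y"
  have n: "x \<bullet> x = 1" "y \<bullet> y = 1" "z \<bullet> z = 1"
    using S by (auto simp: norm_eq_1)
  have sx: "sin (geodesic_dist x y) = norm ?p"
    using S n abs_inner_S2[of x y]
    by (simp add: geodesic_dist_def sin_arccos abs_le_iff norm_eq_sqrt_inner power2_eq_square
        inner_diff_left inner_diff_right inner_commute)
  have sz: "sin (geodesic_dist y z) = norm ?r"
    using S n abs_inner_S2[of z y]
    by (simp add: geodesic_dist_def sin_arccos abs_le_iff norm_eq_sqrt_inner power2_eq_square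
        inner_diff_left inner_diff_right inner_commute)
  have "- (norm ?p * norm ?r) \<le> ?p \<bullet> ?r"
    using Cauchy_Schwarz_ineq2[of ?p ?r] by linarith
  also have "?p \<bullet> ?r = x \<bullet> z - (x \<bullet> y) * (y \<bullet> z)"
    using n by (simp add: inner_diff_left inner_diff_right inner_commute)
  finally have "cos (geodesic_dist x y + geodesic_dist y z) \<le> cos (geodesic_dist x z)"
    using S by (simp add: cos_add sx sz cos_geodesic_dist)
  then show ?thesis
    using True S by (simp add: cos_mono_le_eq geodesic_dist_bounds add_nonneg_nonneg)
next
  case False
  then show ?thesis
    using geodesic_dist_bounds(2)[of x z] S by linarith
qed

lemma infinite_S2: "infinite S2"
proof
  assume "finite S2"
  then have "S2 = {} \<or> (\<exists>a. S2 = {a})"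
    using connected_finite_iff_sing[of S2] connected_sphere[of "0 :: real^3" 1] by simp
  moreover have "axis 1 1 \<in> S2" "- axis 1 1 \<in> S2"
    by (simp_all add: norm_axis_1)
  ultimately have "axis 1 1 = - (axis 1 1 :: real^3)"
    by (metis empty_iff singletonD)
  then have "(axis 1 1 :: real^3) $ 1 = (- axis 1 1 :: real^3) $ 1"
    by (rule arg_cong[where f = "\<lambda>v. v $ 1"])
  then show False
    by (simp add: axis_def)
qed

text \<open>With a nonpositive radius the net would contain the whole infinite sphere. This is the
  source of \<epsilon> > 0 in the lower bound.\<close>

lemma geodesic_net_finite_imp_pos:
  assumes "geodesic_net d X" "finite X" "X \<subseteq> S2"
  shows "d > 0"
proof (rule ccontr)
  assume "\<not> d > 0"
  have "S2 \<subseteq> X"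
  proof
    fix y assume y: "y \<in> S2"
    then obtain x where x: "x \<in> X" "geodesic_dist y x \<le> d"
      using assms(1) unfolding geodesic_net_def by blast
    then have "geodesic_dist y x = 0"
      using y assms(3) \<open>\<not> d > 0\<close> geodesic_dist_bounds(1)[of y x] by force
    then have "y \<bullet> x = 1"
      using cos_geodesic_dist[of y x] y x assms(3) by auto
    then have "(norm (y - x))\<^sup>2 = 0"
      using y x assms(3) unfolding power2_norm_eq_inner
      by (auto simp: inner_diff_left inner_diff_right inner_commute norm_eq_1)
    then show "y \<in> X"
      using x by simp
  qed
  then show False
    using assms(2) infinite_S2 finite_subset by blast
qed

section \<open>Lower bound\<close>

lemma net_not_3_colourable:
  assumes \<alpha>: "\<epsilon> < \<alpha>" "\<alpha> \<le> pi" and X: "finite X" "X \<subseteq> S2" and net: "geodesic_net (\<epsilon> / 4) X"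
  shows "\<not> colourable (distance_graph \<alpha> \<epsilon> X) 3"
proof
  assume "colourable (distance_graph \<alpha> \<epsilon> X) 3"
  then obtain c :: "real^3 \<Rightarrow> nat" where c: "\<And>x. x \<in> X \<Longrightarrow> c x < 3"
    and proper: "\<And>x y. x \<in> X \<Longrightarrow> y \<in> X \<Longrightarrow> x \<noteq> y \<Longrightarrow> \<alpha> - \<epsilon> \<le> geodesic_dist x y \<Longrightarrow>
        geodesic_dist x y \<le> \<alpha> + \<epsilon> \<Longrightarrow> c x \<noteq> c y"
    unfolding colourable_def distance_graph_def by (fastforce simp: Pi_iff)
  have \<epsilon>: "\<epsilon> > 0"
    using geodesic_net_finite_imp_pos[OF net X] by simp
  \<comment> \<open>Each truncated term is continuous and is positive exactly within distance
    \<epsilon>/2 of \<open>x\<close>. This radius exceeds the net radius \<epsilon>/4, so some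
    weight is positive everywhere, and two such radii add up to the tolerance \<epsilon> of the
    graph.\<close>
  define w where "w i p = (\<Sum>x\<in>{x\<in>X. c x = i}. max 0 (p \<bullet> x - cos (\<epsilon> / 2)))" for i :: nat and p
  have w_pos: "w i p > 0 \<longleftrightarrow> (\<exists>x\<in>X. c x = i \<and> geodesic_dist p x < \<epsilon> / 2)" if "p \<in> S2" for i p
  proof -
    have "geodesic_dist p x < \<epsilon> / 2 \<longleftrightarrow> max 0 (p \<bullet> x - cos (\<epsilon> / 2)) > 0" if "x \<in> X" for x
      using geodesic_dist_less_iff[of p x "\<epsilon> / 2"] \<epsilon> \<alpha> that \<open>p \<in> S2\<close> X(2) by auto
    moreover have "w i p > 0 \<longleftrightarrow> (\<exists>x\<in>{x\<in>X. c x = i}. max 0 (p \<bullet> x - cos (\<epsilon> / 2)) > 0)"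
    proof
      assume "w i p > 0"
      then show "\<exists>x\<in>{x\<in>X. c x = i}. max 0 (p \<bullet> x - cos (\<epsilon> / 2)) > 0"
        unfolding w_def by (rule contrapos_pp) (simp add: not_less sum_nonpos)
    next
      assume "\<exists>x\<in>{x\<in>X. c x = i}. max 0 (p \<bullet> x - cos (\<epsilon> / 2)) > 0"
      then obtain x where "x \<in> {x\<in>X. c x = i}" "max 0 (p \<bullet> x - cos (\<epsilon> / 2)) > 0"
        by blast
      then show "w i p > 0"
        unfolding w_def by (rule sum_pos2[rotated]) (use X(1) in auto)
    qed
    ultimately show ?thesis
      by auto
  qed
  have w_nonneg: "w i p \<ge> 0" for i p
    unfolding w_def by (intro sum_nonneg) simp
  have w_ex: "\<exists>i<3. w i p > 0" if p: "p \<in> S2" for p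
  proof -
    obtain x where "x \<in> X" "geodesic_dist p x \<le> \<epsilon> / 4"
      using net p unfolding geodesic_net_def by blast
    moreover from this have "geodesic_dist p x < \<epsilon> / 2"
      using \<epsilon> by linarith
    ultimately show ?thesis
      using w_pos[OF p, of "c x"] c by blast
  qed
  have w_disj: "w i q = 0" if pq: "p \<in> S2" "q \<in> S2" "p \<bullet> q = cos \<alpha>" "w i p > 0" for i p q
  proof (rule ccontr)
    assume "w i q \<noteq> 0"
    then have "w i q > 0"
      using w_nonneg[of i q] by simp
    then obtain x y where x: "x \<in> X" "c x = i" "geodesic_dist p x < \<epsilon> / 2"
      and y: "y \<in> X" "c y = i" "geodesic_dist q y < \<epsilon> / 2"
      using pq w_pos by meson
    have dpq: "geodesic_dist p q = \<alpha>"
      using pq \<epsilon> \<alpha> by (simp add: geodesic_dist_def arccos_cos)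
    have S: "x \<in> S2" "y \<in> S2"
      using x y X by auto
    \<comment> \<open>The triangle inequality is used in both directions: moving each endpoint by
      less than \<epsilon>/2 changes the distance \<alpha> by less than \<epsilon>.\<close>
    have "geodesic_dist p q \<le> geodesic_dist p x + geodesic_dist x y + geodesic_dist q y"
      using geodesic_dist_triangle[of p x q] geodesic_dist_triangle[of x y q] S pq
      by (simp add: geodesic_dist_commute[of q y])
    moreover have "geodesic_dist x y \<le> geodesic_dist p x + geodesic_dist p q + geodesic_dist q y"
      using geodesic_dist_triangle[of x p y] geodesic_dist_triangle[of p q y] S pq
      by (simp add: geodesic_dist_commute[of x p])
    ultimately have d: "\<alpha> - \<epsilon> \<le> geodesic_dist x y" "geodesic_dist x y \<le> \<alpha> + \<epsilon>"
      using x y dpq by linarith+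
    have "x \<noteq> y"
    proof
      assume "x = y"
      then have "geodesic_dist x y = 0"
        using S by (simp add: geodesic_dist_def norm_eq_1)
      with d \<alpha> show False
        by simp
    qed
    with proper[OF x(1) y(1)] d x y show False
      by simp
  qed
  text \<open>Two points have the same image iff their triples of weights differ by a multiple of
    \<open>(1, 1, 1)\<close>, which disjoint nonempty supports exclude.\<close>
  define f where "f p = Complex (w 0 p - w 2 p) (w 1 p - w 2 p)" for p
  have "continuous_on S2 f"
    unfolding f_def Complex_eq w_def by (intro continuous_intros)
  then obtain p q where pq: "p \<in> S2" "q \<in> S2" "p \<bullet> q = cos \<alpha>" "f p = f q"
    using equal_values_at_inner_product[of f "cos \<alpha>"] by auto
  then have eq: "w 0 p - w 0 q = w 2 p - w 2 q" "w 1 p - w 1 q = w 2 p - w 2 q"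
    by (auto simp: f_def)
  have eq3: "w i p - w i q = w 2 p - w 2 q" if "i < 3" for i
    using eq that by (auto simp: less_Suc_eq numeral_3_eq_3 numeral_2_eq_2)
  obtain i where i: "i < 3" "w i p > 0"
    using w_ex pq by blast
  obtain j where j: "j < 3" "w j q > 0"
    using w_ex pq by blast
  have "w i q = 0" "w j p = 0"
    using w_disj[OF pq(1-3) i(2)] w_disj[of q p j] pq(1-3) j(2) by (simp_all add: inner_commute)
  \<comment> \<open>The common difference of weights is positive by colour \<open>i\<close> and
    negative by colour \<open>j\<close>.\<close>
  then show False
    using eq3[OF i(1)] eq3[OF j(1)] i j by linarith
qed

section \<open>Upper bound\<close>

text \<open>The cone \<open>x\<^sub>1 + x\<^sub>2 \<ge> 0\<close>, \<open>x\<^sub>1 + x\<^sub>3 \<ge> 0\<close>, \<open>x\<^sub>2 + x\<^sub>3 \<ge> 0\<close> is spanned by \<open>(-1, 1, 1)\<close>, \<open>(1, -1, 1)\<close>,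
  \<open>(1, 1, -1)\<close>, three vertices of a regular tetrahedron. The remaining faces arise from it by
  changing two signs. A point of the cone has at most one negative coordinate.\<close>

lemma cone_neg_nonneg:
  fixes x1 x2 x3 y1 y2 y3 :: real
  assumes neg: "x1 * y1 + x2 * y2 + x3 * y3 < 0"
    and "x1 + x3 \<ge> 0" "x2 + x3 \<ge> 0" "x3 \<le> 0" "y1 \<ge> 0" "y2 \<ge> 0" "y3 \<ge> 0"
  shows "3 * (x1 * y1 + x2 * y2 + x3 * y3)\<^sup>2 \<le> (x1\<^sup>2 + x2\<^sup>2 + x3\<^sup>2) * (y1\<^sup>2 + y2\<^sup>2 + y3\<^sup>2)"
proof -
  \<comment> \<open>Since \<open>x1\<close> and \<open>x2\<close> are at least \<open>- x3\<close>,
    only the third product can be negative, and \<open>x3\<close> squared is at most a third of the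
    squared norm.\<close>
  have "0 \<le> x1 * y1" "0 \<le> x2 * y2"
    using assms by (auto intro!: mult_nonneg_nonneg)
  then have "\<bar>x1 * y1 + x2 * y2 + x3 * y3\<bar> \<le> \<bar>x3 * y3\<bar>"
    using neg by linarith
  then have "(x1 * y1 + x2 * y2 + x3 * y3)\<^sup>2 \<le> (x3 * y3)\<^sup>2"
    by (simp only: abs_le_square_iff)
  then have "3 * (x1 * y1 + x2 * y2 + x3 * y3)\<^sup>2 \<le> (3 * x3\<^sup>2) * y3\<^sup>2"
    by (simp add: power_mult_distrib)
  also have "\<dots> \<le> (x1\<^sup>2 + x2\<^sup>2 + x3\<^sup>2) * (y1\<^sup>2 + y2\<^sup>2 + y3\<^sup>2)"
  proof (rule mult_mono)
    have "x3\<^sup>2 \<le> x1\<^sup>2" "x3\<^sup>2 \<le> x2\<^sup>2"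
      using assms by (auto simp: abs_le_square_iff[symmetric])
    then show "3 * x3\<^sup>2 \<le> x1\<^sup>2 + x2\<^sup>2 + x3\<^sup>2"
      by linarith
  qed auto
  finally show ?thesis .
qed

text \<open>The case of negative coordinates in different positions. After a reduction to four
  nonnegative parameters, the difference of the two sides is a sum of squares and nonnegative
  monomials.\<close>

lemma cone_neg_neg:
  fixes x1 x2 x3 y1 y2 y3 :: real
  assumes neg: "x1 * y1 + x2 * y2 + x3 * y3 < 0"
    and x: "x1 + x3 \<ge> 0" "x2 + x3 \<ge> 0" "x3 \<le> 0"
    and y: "y1 + y2 \<ge> 0" "y2 + y3 \<ge> 0" "y2 \<le> 0"
  shows "3 * (x1 * y1 + x2 * y2 + x3 * y3)\<^sup>2 \<le> (x1\<^sup>2 + x2\<^sup>2 + x3\<^sup>2) * (y1\<^sup>2 + y2\<^sup>2 + y3\<^sup>2)"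
proof -
  \<comment> \<open>\<open>b\<close> and \<open>e\<close> are the sizes of the negative coordinates;
    \<open>s\<close> and \<open>t\<close> are slacks in the cone inequalities, so
    \<open>x2 = b + s\<close> and \<open>y3 = e + t\<close>.\<close>
  define b e s t where "b = - x3" and "e = - y2" and "s = x2 + x3" and "t = y3 + y2"
  note d = b_def e_def s_def t_def
  have nn: "b \<ge> 0" "e \<ge> 0" "s \<ge> 0" "t \<ge> 0"
    using x y by (auto simp: d)
  text \<open>Lowering the first coordinates to \<open>b\<close> and \<open>e\<close> only strengthens the claim.\<close>
  let ?M = "b * e + s * e + t * b"
  have "b * e \<le> x1 * y1"
    using x y by (intro mult_mono) (auto simp: d)
  then have "\<bar>x1 * y1 + x2 * y2 + x3 * y3\<bar> \<le> \<bar>?M\<bar>"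
    using neg by (simp add: d algebra_simps)
  then have "3 * (x1 * y1 + x2 * y2 + x3 * y3)\<^sup>2 \<le> 3 * ?M\<^sup>2"
    by (simp add: abs_le_square_iff)
  also have "3 * ?M\<^sup>2 \<le> (2 * b\<^sup>2 + (b + s)\<^sup>2) * (2 * e\<^sup>2 + (e + t)\<^sup>2)"
  proof -
    have "(2 * b\<^sup>2 + (b + s)\<^sup>2) * (2 * e\<^sup>2 + (e + t)\<^sup>2) - 3 * ?M\<^sup>2
        = 5 * (b * e)\<^sup>2 + (b * e - s * t)\<^sup>2 + 2 * (b * (s * t\<^sup>2)) + 2 * (s\<^sup>2 * (e * t))"
      by (simp add: power2_eq_square algebra_simps)
    also have "\<dots> \<ge> 0"
      using nn by (intro add_nonneg_nonneg mult_nonneg_nonneg) auto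
    finally show ?thesis
      by simp
  qed
  also have "\<dots> \<le> (x1\<^sup>2 + x2\<^sup>2 + x3\<^sup>2) * (y1\<^sup>2 + y2\<^sup>2 + y3\<^sup>2)"
  proof (rule mult_mono)
    have "b\<^sup>2 \<le> x1\<^sup>2" "e\<^sup>2 \<le> y1\<^sup>2"
      using x y by (auto simp: d abs_le_square_iff[symmetric])
    then show "2 * b\<^sup>2 + (b + s)\<^sup>2 \<le> x1\<^sup>2 + x2\<^sup>2 + x3\<^sup>2" "2 * e\<^sup>2 + (e + t)\<^sup>2 \<le> y1\<^sup>2 + y2\<^sup>2 + y3\<^sup>2"
      by (auto simp: d)
  qed auto
  finally show ?thesis .
qed

text \<open>Bounds the cosine of the angle between two cone vectors below by
  \<open>-1 / sqrt 3\<close>. Up to permuting coordinates and exchanging \<open>x\<close> and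
  \<open>y\<close>, the two preceding lemmas cover all sign patterns; with negative coordinates in
  the same position, or none, every product is nonnegative.\<close>

lemma cone_inner_neg:
  fixes x1 x2 x3 y1 y2 y3 :: real
  assumes x: "x1 + x2 \<ge> 0" "x1 + x3 \<ge> 0" "x2 + x3 \<ge> 0"
    and y: "y1 + y2 \<ge> 0" "y1 + y3 \<ge> 0" "y2 + y3 \<ge> 0"
    and neg: "x1 * y1 + x2 * y2 + x3 * y3 < 0"
  shows "3 * (x1 * y1 + x2 * y2 + x3 * y3)\<^sup>2 \<le> (x1\<^sup>2 + x2\<^sup>2 + x3\<^sup>2) * (y1\<^sup>2 + y2\<^sup>2 + y3\<^sup>2)"
proof -
  have same: False
    if "x1 * y1 \<ge> 0" "x2 * y2 \<ge> 0" "x3 * y3 \<ge> 0"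
    using that neg by linarith
  consider "x1 \<ge> 0" "x2 \<ge> 0" "x3 \<ge> 0" | "x1 < 0" "x2 \<ge> 0" "x3 \<ge> 0"
    | "x2 < 0" "x1 \<ge> 0" "x3 \<ge> 0" | "x3 < 0" "x1 \<ge> 0" "x2 \<ge> 0"
    using x by linarith
  note cx = this
  consider "y1 \<ge> 0" "y2 \<ge> 0" "y3 \<ge> 0" | "y1 < 0" "y2 \<ge> 0" "y3 \<ge> 0"
    | "y2 < 0" "y1 \<ge> 0" "y3 \<ge> 0" | "y3 < 0" "y1 \<ge> 0" "y2 \<ge> 0"
    using y by linarith
  note cy = this
  note A = cone_neg_nonneg and B = cone_neg_neg
  show ?thesis
    using x y neg
    apply (cases rule: cx; cases rule: cy)
    subgoal using same by (auto simp: zero_le_mult_iff)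
    subgoal using A[of y2 x2 y3 x3 y1 x1] by (simp add: ac_simps)
    subgoal using A[of y1 x1 y3 x3 y2 x2] by (simp add: ac_simps)
    subgoal using A[of y1 x1 y2 x2 y3 x3] by (simp add: ac_simps)
    subgoal using A[of x2 y2 x3 y3 x1 y1] by (simp add: ac_simps)
    subgoal using same by (auto simp: zero_le_mult_iff)
    subgoal using B[of x3 y3 x2 y2 x1 y1] by (simp add: ac_simps)
    subgoal using B[of x2 y2 x3 y3 x1 y1] by (simp add: ac_simps)
    subgoal using A[of x1 y1 x3 y3 x2 y2] by (simp add: ac_simps)
    subgoal using B[of x3 y3 x1 y1 x2 y2] by (simp add: ac_simps)
    subgoal using same by (auto simp: zero_le_mult_iff)
    subgoal using B[of x1 y1 x3 y3 x2 y2] by (simp add: ac_simps)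
    subgoal using A[of x1 y1 x2 y2 x3 y3] by (simp add: ac_simps)
    subgoal using B[of x2 y2 x1 y1 x3 y3] by (simp add: ac_simps)
    subgoal using B[of x1 y1 x2 y2 x3 y3] by (simp add: ac_simps)
    subgoal using same by (auto simp: zero_le_mult_iff)
    done
qed

text \<open>The colour classes lie in the cones over the four faces. The sign changes relating these
  cones preserve inner products, so the bound for one cone serves all.\<close>

lemma exists_tetrahedral_colouring:
  "\<exists>col :: real^3 \<Rightarrow> nat. (\<forall>x. col x < 4) \<and>
     (\<forall>x\<in>S2. \<forall>y\<in>S2. col x = col y \<longrightarrow> - 1 / sqrt 3 \<le> x \<bullet> y)"
proof -
  define C :: "real \<Rightarrow> real \<Rightarrow> real \<Rightarrow> (real^3) set" where
    "C s1 s2 s3 = {x. s1 * x $ 1 + s2 * x $ 2 \<ge> 0 \<and> s1 * x $ 1 + s3 * x $ 3 \<ge> 0 \<and> s2 * x $ 2 + s3 * x $ 3 \<ge> 0}"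
    for s1 s2 s3
  have C: "- 1 / sqrt 3 \<le> x \<bullet> y"
    if s: "{s1, s2, s3} \<subseteq> {-1, 1}" and xy: "x \<in> C s1 s2 s3" "y \<in> C s1 s2 s3" "x \<in> S2" "y \<in> S2"
    for s1 s2 s3 x y
  proof (cases "x \<bullet> y < 0")
    case True
    have ss: "(s1 * a) * (s1 * b) = a * b" "(s2 * a) * (s2 * b) = a * b" "(s3 * a) * (s3 * b) = a * b"
      "(s1 * a)\<^sup>2 = a\<^sup>2" "(s2 * a)\<^sup>2 = a\<^sup>2" "(s3 * a)\<^sup>2 = a\<^sup>2" for a b
      using s by auto
    have n: "(x $ 1)\<^sup>2 + (x $ 2)\<^sup>2 + (x $ 3)\<^sup>2 = 1" "(y $ 1)\<^sup>2 + (y $ 2)\<^sup>2 + (y $ 3)\<^sup>2 = 1"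
      using xy by (simp_all add: norm_eq_1 inner_vec_def sum_3 power2_eq_square)
    have "3 * (x \<bullet> y)\<^sup>2 \<le> 1"
      using cone_inner_neg[of "s1 * x $ 1" "s2 * x $ 2" "s3 * x $ 3" "s1 * y $ 1" "s2 * y $ 2" "s3 * y $ 3"]
        xy(1,2) True unfolding ss n by (simp add: C_def inner_vec_def sum_3)
    then have "(sqrt 3 * (x \<bullet> y))\<^sup>2 \<le> 1"
      by (simp add: power_mult_distrib)
    then have "\<bar>sqrt 3 * (x \<bullet> y)\<bar> \<le> 1"
      by (simp only: abs_square_le_1)
    then show ?thesis
      by (simp add: abs_le_iff field_simps)
  next
    case False
    moreover have "- 1 / sqrt 3 \<le> 0"
      by simp
    ultimately show ?thesis
      by linarith
  qed
  \<comment> \<open>A point lies in the cone over the face opposite the tetrahedron vertex with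
    which it has the smallest inner product.\<close>
  have cover: "x \<in> C 1 1 1 \<or> x \<in> C 1 (-1) (-1) \<or> x \<in> C (-1) 1 (-1) \<or> x \<in> C (-1) (-1) 1" for x
    unfolding C_def by simp linarith
  define col :: "real^3 \<Rightarrow> nat" where
    "col x = (if x \<in> C 1 1 1 then 0 else if x \<in> C 1 (-1) (-1) then 1
      else if x \<in> C (-1) 1 (-1) then 2 else 3)" for x
  have "- 1 / sqrt 3 \<le> x \<bullet> y" if xy: "x \<in> S2" "y \<in> S2" "col x = col y" for x y
  proof -
    obtain s1 s2 s3 where "{s1, s2, s3} \<subseteq> {-1, 1}" "x \<in> C s1 s2 s3" "y \<in> C s1 s2 s3"
    proof -
      consider "x \<in> C 1 1 1" "y \<in> C 1 1 1" | "x \<in> C 1 (-1) (-1)" "y \<in> C 1 (-1) (-1)"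
        | "x \<in> C (-1) 1 (-1)" "y \<in> C (-1) 1 (-1)" | "x \<in> C (-1) (-1) 1" "y \<in> C (-1) (-1) 1"
        using xy(3) cover[of x] cover[of y] unfolding col_def by (auto split: if_splits)
      then show thesis
        using that by cases auto
    qed
    then show ?thesis
      using C xy by blast
  qed
  moreover have "col x < 4" for x
    by (simp add: col_def)
  ultimately show ?thesis
    by blast
qed

text \<open>By the double-angle formula \<open>cos (2 * arcsin u) = 1 - 2 * u^2\<close>, which here
  equals \<open>- 2 / sqrt 12\<close>.\<close>

lemma lambda2_eq_arccos: "lambda2 = arccos (- 1 / sqrt 3)"
proof -
  define u :: real where "u = sqrt (1 / 2 + 1 / sqrt 12)"
  have r: "sqrt 12 = 2 * sqrt (3::real)"
    using real_sqrt_mult[of 4 3] by simp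
  have "1 \<le> sqrt (3::real)"
    by simp
  then have "1 / 2 + 1 / sqrt 12 \<le> (1 :: real)"
    by (simp add: r field_simps)
  then have u: "0 \<le> u" "u \<le> 1" "u\<^sup>2 = 1 / 2 + 1 / sqrt 12"
    by (simp_all add: u_def)
  have "cos (2 * arcsin u) = - 1 / sqrt 3"
    using u by (simp add: cos_double_sin r)
  moreover have "0 \<le> 2 * arcsin u" "2 * arcsin u \<le> pi"
    using u arcsin_bounded[of u] arcsin_le_arcsin[of 0 u] by auto
  ultimately show ?thesis
    using arccos_cos unfolding lambda2_def u_def by metis
qed

lemma distance_graph_4_colourable:
  assumes "lambda2 < \<alpha> - \<epsilon>" "X \<subseteq> S2"
  shows "colourable (distance_graph \<alpha> \<epsilon> X) 4"
proof -
  obtain col :: "real^3 \<Rightarrow> nat" where col: "\<And>x. col x < 4"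
    and diam: "\<And>x y. x \<in> S2 \<Longrightarrow> y \<in> S2 \<Longrightarrow> col x = col y \<Longrightarrow> - 1 / sqrt 3 \<le> x \<bullet> y"
    using exists_tetrahedral_colouring by blast
  have "col x \<noteq> col y" if "x \<in> X" "y \<in> X" "\<alpha> - \<epsilon> \<le> geodesic_dist x y" for x y
  proof
    assume "col x = col y"
    moreover have S: "x \<in> S2" "y \<in> S2"
      using that assms(2) by blast+
    ultimately have "- 1 / sqrt 3 \<le> x \<bullet> y" "x \<bullet> y \<le> 1"
      using diam[OF S] abs_inner_S2[OF S] by (simp_all add: abs_le_iff)
    then have "geodesic_dist x y \<le> lambda2"
      unfolding geodesic_dist_def lambda2_eq_arccos by (intro arccos_le_arccos) auto
    with that assms show False
      by linarith
  qed
  then show ?thesis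
    using col unfolding colourable_def distance_graph_def by (intro exI[of _ col]) auto
qed

section \<open>The random graph\<close>

lemma colourable_mono: "colourable G k \<Longrightarrow> k \<le> l \<Longrightarrow> colourable G l"
  unfolding colourable_def Pi_iff lessThan_iff by (meson order.strict_trans2)

lemma chromatic_number_eq_Suc_iff:
  assumes "colourable G (Suc k)"
  shows "chromatic_number G = Suc k \<longleftrightarrow> \<not> colourable G k"
proof
  assume "chromatic_number G = Suc k"
  then show "\<not> colourable G k"
    unfolding chromatic_number_def by (metis lessI not_less_Least)
next
  assume "\<not> colourable G k"
  then show "chromatic_number G = Suc k"
    unfolding chromatic_number_def using assms colourable_mono[of G _ k]
    by (intro Least_equality) (auto simp: not_less_eq_eq[symmetric])
qed

text \<open>Colouring indices instead of points makes the range of \<open>c\<close> a finite set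
  independent of \<open>f\<close>, as the measurability proof requires. Indices with coinciding
  points must share a colour.\<close>

lemma colourable_distance_graph_image_iff:
  "colourable (distance_graph \<alpha> \<epsilon> (f ` I)) k \<longleftrightarrow>
    (\<exists>c\<in>I \<rightarrow>\<^sub>E {..<k}. \<forall>i\<in>I. \<forall>j\<in>I. if f i = f j then c i = c j
       else \<alpha> - \<epsilon> \<le> geodesic_dist (f i) (f j) \<and> geodesic_dist (f i) (f j) \<le> \<alpha> + \<epsilon> \<longrightarrow> c i \<noteq> c j)"
  (is "?L \<longleftrightarrow> (\<exists>c\<in>_. ?proper c)")
proof
  assume ?L
  then obtain c where c: "c \<in> fst (distance_graph \<alpha> \<epsilon> (f ` I)) \<rightarrow> {..<k}"
    and ne: "\<forall>(x, y)\<in>snd (distance_graph \<alpha> \<epsilon> (f ` I)). c x \<noteq> c y"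
    unfolding colourable_def by blast
  show "\<exists>c\<in>I \<rightarrow>\<^sub>E {..<k}. ?proper c"
  proof (intro bexI ballI)
    show "(\<lambda>i\<in>I. c (f i)) \<in> I \<rightarrow>\<^sub>E {..<k}"
      using c by (simp add: distance_graph_def Pi_iff)
  qed (use ne in \<open>simp add: distance_graph_def\<close>)
next
  assume "\<exists>c\<in>I \<rightarrow>\<^sub>E {..<k}. ?proper c"
  then obtain c where c: "c \<in> I \<rightarrow>\<^sub>E {..<k}" and proper: "?proper c"
    by blast
  \<comment> \<open>A point takes the colour of a chosen index representing it; this is well defined
    because \<open>c\<close> is constant on fibres of \<open>f\<close>.\<close>
  have inv: "c (inv_into I f (f i)) = c i" if "i \<in> I" for i
    using bspec[OF bspec[OF proper, of "inv_into I f (f i)"] that] that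
    by (simp add: f_inv_into_f inv_into_into)
  have "c (inv_into I f (f i)) \<noteq> c (inv_into I f (f j))"
    if "i \<in> I" "j \<in> I" "f i \<noteq> f j" "\<alpha> - \<epsilon> \<le> geodesic_dist (f i) (f j)"
      "geodesic_dist (f i) (f j) \<le> \<alpha> + \<epsilon>" for i j
    using bspec[OF bspec[OF proper that(1)] that(2)] that inv by simp
  moreover have "c (inv_into I f (f i)) < k" if "i \<in> I" for i
    using c that inv by (simp add: PiE_iff)
  ultimately show ?L
    unfolding colourable_def distance_graph_def by (intro exI[of _ "\<lambda>x. c (inv_into I f x)"]) auto
qed

text \<open>Clamping to the interval from -1 to 1 makes \<open>arccos\<close> continuous on the
  whole line and changes nothing at inner products of unit vectors.\<close>

lemma borel_measurable_clamped_arccos: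
  "(\<lambda>t::real. arccos (max (- 1) (min 1 t))) \<in> borel_measurable borel"
  by (intro borel_measurable_continuous_onI continuous_on_arccos continuous_intros) auto

text \<open>The event is a finite union, over index colourings, of finite intersections of
  conditions on pairs of coordinates.\<close>

lemma sets_colourable:
  "{\<omega> \<in> space (iid_points n). colourable (distance_graph \<alpha> \<epsilon> (\<omega> ` {1..n})) k} \<in> sets (iid_points n)"
proof -
  let ?M = "iid_points n"
  have id: "(\<lambda>x. x) \<in> borel_measurable sphere_uniform"
    unfolding measurable_cong_sets[OF sets_sphere_uniform refl]
    by (intro measurable_restrict_space1) simp
  have comp: "(\<lambda>\<omega>. \<omega> i) \<in> borel_measurable ?M" if "i \<in> {1..n}" for i
    unfolding iid_points_def
    by (rule measurable_compose[OF measurable_component_singleton[OF that] id])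
  have space: "\<omega> i \<in> S2" if "\<omega> \<in> space ?M" "i \<in> {1..n}" for \<omega> i
    using that by (auto simp: iid_points_def space_PiM space_sphere_uniform)
  have dist: "(\<lambda>\<omega>. geodesic_dist (\<omega> i) (\<omega> j)) \<in> borel_measurable ?M"
    if ij: "i \<in> {1..n}" "j \<in> {1..n}" for i j
  proof -
    have "(\<lambda>\<omega>. arccos (max (- 1) (min 1 (\<omega> i \<bullet> \<omega> j)))) \<in> borel_measurable ?M"
      by (rule measurable_compose[OF borel_measurable_inner[OF comp comp] borel_measurable_clamped_arccos])
        (use ij in auto)
    moreover have "arccos (max (- 1) (min 1 (\<omega> i \<bullet> \<omega> j))) = geodesic_dist (\<omega> i) (\<omega> j)"
      if "\<omega> \<in> space ?M" for \<omega>
      using abs_inner_S2[OF space[OF that] space[OF that]] ij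
      by (simp add: geodesic_dist_def abs_le_iff max_absorb2 min_absorb2)
    ultimately show ?thesis
      by (simp cong: measurable_cong)
  qed
  have pair: "Measurable.pred ?M (\<lambda>\<omega>. if \<omega> i = \<omega> j then c i = c j
       else \<alpha> - \<epsilon> \<le> geodesic_dist (\<omega> i) (\<omega> j) \<and> geodesic_dist (\<omega> i) (\<omega> j) \<le> \<alpha> + \<epsilon> \<longrightarrow> c i \<noteq> c j)"
    if ij: "i \<in> {1..n}" "j \<in> {1..n}" for i j and c :: "nat \<Rightarrow> nat"
  proof -
    note [measurable] = comp[OF ij(1)] comp[OF ij(2)] dist[OF ij]
    show ?thesis
      by measurable
  qed
  have "Measurable.pred ?M (\<lambda>\<omega>. colourable (distance_graph \<alpha> \<epsilon> (\<omega> ` {1..n})) k)"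
    unfolding colourable_distance_graph_image_iff
  proof (rule pred_intros_finite(4))
    show "finite ({1..n} \<rightarrow>\<^sub>E {..<k})"
      by (intro finite_PiE) auto
  qed (rule pred_intros_finite(3)[OF finite_atLeastAtMost]
      pred_intros_finite(3)[OF finite_atLeastAtMost] pair | assumption)+
  then show ?thesis
    by (simp add: pred_def)
qed

lemma prob_space_iid_points: "prob_space (iid_points n)"
  unfolding iid_points_def by (intro prob_space_PiM prob_space_sphere_uniform)

theorem theorem5p2:
  fixes \<alpha> C\<^sub>2 :: real and \<epsilon> :: "nat \<Rightarrow> real"
  assumes "net_constant C\<^sub>2"
    and "lambda2 < \<alpha>" and "\<alpha> \<le> pi"
    and "\<forall>n\<ge>1. \<epsilon> n \<ge> C\<^sub>2 * sqrt (ln (real n) / real n)"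
    and "\<epsilon> \<longlonglongrightarrow> 0"
  shows "aas iid_points
    (\<lambda>n \<omega>. chromatic_number (distance_graph \<alpha> (\<epsilon> n) (\<omega> ` {1..n})) = 4)"
proof -
  let ?G = "\<lambda>n \<omega>. distance_graph \<alpha> (\<epsilon> n) (\<omega> ` {1..n})"
  let ?net = "\<lambda>n \<omega>. geodesic_net (\<epsilon> n / 4) (\<omega> ` {1..n})"
  let ?four = "\<lambda>n \<omega>. colourable (?G n \<omega>) 4 \<and> \<not> colourable (?G n \<omega>) 3"
  \<comment> \<open>Nonnegativity of \<open>lambda2\<close> turns \<epsilon> < \<alpha> -
    \<open>lambda2\<close> into the bound \<epsilon> < \<alpha> of the lower-bound lemma.\<close>
  have "- 1 / sqrt 3 \<le> (0 :: real)"
    by simp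
  then have "lambda2 \<ge> 0"
    unfolding lambda2_eq_arccos by (intro arccos_lbound) (simp, linarith)
  have S: "\<omega> ` {1..n} \<subseteq> S2" if "\<omega> \<in> space (iid_points n)" for n \<omega>
    using that by (auto simp: iid_points_def space_PiM space_sphere_uniform)
  have small: "\<forall>\<^sub>F n in sequentially. \<epsilon> n < \<alpha> - lambda2"
    using assms(2,5) by (intro order_tendstoD) auto
  have four: "chromatic_number (?G n \<omega>) = 4 \<longleftrightarrow> ?four n \<omega>"
    if "\<epsilon> n < \<alpha> - lambda2" "\<omega> \<in> space (iid_points n)" for n \<omega>
    using distance_graph_4_colourable[OF _ S[OF that(2)], of \<alpha> "\<epsilon> n"] that(1)
      chromatic_number_eq_Suc_iff[of "?G n \<omega>" 3] by (auto simp: eval_nat_numeral)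
  have le: "\<forall>\<^sub>F n in sequentially. \<P>(\<omega> in iid_points n. ?net n \<omega>)
      \<le> \<P>(\<omega> in iid_points n. chromatic_number (?G n \<omega>) = 4)"
    using small
  proof eventually_elim
    case (elim n)
    interpret prob_space "iid_points n"
      by (rule prob_space_iid_points)
    have eq: "{\<omega> \<in> space (iid_points n). chromatic_number (?G n \<omega>) = 4}
        = {\<omega> \<in> space (iid_points n). ?four n \<omega>}"
      using four[OF elim] by blast
    have "?four n \<omega>" if "\<omega> \<in> space (iid_points n)" "?net n \<omega>" for \<omega>
      using net_not_3_colourable[OF _ assms(3) _ S[OF that(1)] that(2)]
        distance_graph_4_colourable[OF _ S[OF that(1)]] elim \<open>lambda2 \<ge> 0\<close> by auto
    \<comment> \<open>Monotonicity of the measure asks for measurability of the larger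
      event.\<close>
    moreover have "{\<omega> \<in> space (iid_points n). ?four n \<omega>} \<in> events"
      using sets_colourable by (intro sets.sets_Collect) auto
    ultimately show ?case
      unfolding eq by (intro finite_measure_mono) auto
  qed
  have net: "(\<lambda>n. \<P>(\<omega> in iid_points n. ?net n \<omega>)) \<longlonglongrightarrow> 1"
    using assms(1,4,5) unfolding net_constant_def aas_def by blast
  show ?thesis
    unfolding aas_def
    by (rule tendsto_sandwich[OF le _ net tendsto_const])
      (intro always_eventually allI prob_space.prob_le_1 prob_space_iid_points)
qed

end
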